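(* Consider an asynchronous network with $n$ processes of which up to $f$ are faulty, where $n > 3f$, and an atomic broadcast protocol for it that satisfies the following notion of order fairness for some $\mu \ge 0$: Weak differential order fairness: for any payload messages $m$ and $m'$, if $b(m,m') > b(m',m) + \mu$, then no correct process a-delivers $m'$ before $m$. Then it must hold that $\mu \ge 2f$.
   Context: System model: $n$ processes communicate over reliable, authenticated, FIFO point-to-point links in an asynchronous network (messages between correct processes are eventually delivered, but with arbitrary delay; no clocks). Up to $f$ processes are Byzantine (deviate arbitrarily); there are $n-f$ correct processes. Processes are computationally bounded, and protocols may use digital signatures and randomization (termination may then be probabilistic). Atomic broadcast: processes invoke a-broadcast$(m)$ for payload messages $m$ and output payload messages by a-deliver events, such that: - Validity: if a correct process a-broadcasts $m$, then every correct process eventually a-delivers $m$. In the context of order fairness this is used under the standing assumption that every payload message is a-broadcast by all correct processes, so it only concerns payloads that all correct processes a-broadcast. - No duplication: no message is a-delivered more than once. - Agreement: if some correct process a-delivers $m$, then every correct process eventually a-delivers $m$. - Total order: if correct processes $p_i$ and $p_j$ both a-deliver $m$ and $m'$, and $p_i$ a-delivers $m$ before $m'$, then $p_j$ also a-delivers $m$ before $m'$. For payload messages $m, m'$ broadcast by correct processes, $b(m,m')$ is the number of correct processes that broadcast $m$ before $m'$ in the execution. It is assumed that every correct process eventually broadcasts both $m$ and $m'$, so that $b(m,m') + b(m',m) = n-f$. *)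

theory Defs
  imports "HOL-Probability.Probability" "HOL-Library.Infinite_Typeclass"
begin

text \<open>
  Processes are the numbers below \<open>n\<close>. Type variables: \<open>'p\<close> payload messages, \<open>'x\<close> protocol
  messages, \<open>'c\<close> contents that can be signed, \<open>'r\<close> random tapes. Payloads are meant to range over
  an infinite type: applications never run out of payloads, and orderings of more than two payloads
  matter for order fairness.
\<close>

datatype ('p, 'x) input =
    ABroadcast 'p      \<comment> \<open>invocation of a-broadcast by the application\<close>
  | Receive nat 'x     \<comment> \<open>message together with its authenticated sender\<close>
  | Internal           \<comment> \<open>spontaneous local step\<close>

datatype ('p, 'x) reaction =
    Send nat 'x        \<comment> \<open>message together with its destination\<close>
  | ADeliver 'p

datatype ('p, 'x) event =
    Input nat "('p, 'x) input"
  | Output nat "('p, 'x) reaction"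

type_synonym ('p, 'x) log = "('p, 'x) event list"

text \<open>
  A process is a deterministic function of its own random tape and of the list of all its inputs so
  far; the value is the list of outputs that it produces on the most recent input. The tapes are
  drawn from a joint distribution: independent local coins are the case of a product measure,
  deterministic protocols that of a point mass, and a dependent distribution also covers a trusted
  setup. \<open>signatures x\<close> is the set of signatures (signer, signed content) occurring in \<open>x\<close>.
\<close>

record ('p, 'x, 'c, 'r) protocol =
  react :: "nat \<Rightarrow> 'r \<Rightarrow> ('p, 'x) input list \<Rightarrow> ('p, 'x) reaction list"
  coins :: "(nat \<Rightarrow> 'r) measure"
  signatures :: "'x \<Rightarrow> (nat \<times> 'c) set"

text \<open>
  Signatures are idealised: this is how the computational bound on processes enters. A process can
  only sign in its own name, and otherwise pass on signatures that it has received. The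
  corresponding restriction on faulty processes is \<open>unforged\<close> below.
\<close>

definition well_formed :: "nat \<Rightarrow> ('p, 'x, 'c, 'r) protocol \<Rightarrow> bool" where
  "well_formed n P \<longleftrightarrow> prob_space (coins P) \<and>
     (\<forall>i<n. \<forall>r h d x j c. Send d x \<in> set (react P i r h) \<longrightarrow> (j, c) \<in> signatures P x \<longrightarrow> j \<noteq> i \<longrightarrow>
        (\<exists>k y. Receive k y \<in> set h \<and> (j, c) \<in> signatures P y))"

definition inputs :: "nat \<Rightarrow> ('p, 'x) log \<Rightarrow> ('p, 'x) input list" where
  "inputs i l = [a. Input k a \<leftarrow> l, k = i]"

definition sent :: "nat \<Rightarrow> nat \<Rightarrow> ('p, 'x) log \<Rightarrow> 'x list" where
  "sent i j l = [x. Output k (Send d x) \<leftarrow> l, k = i \<and> d = j]"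

definition received :: "nat \<Rightarrow> nat \<Rightarrow> ('p, 'x) log \<Rightarrow> 'x list" where
  "received i j l = [x. Input k (Receive s x) \<leftarrow> l, s = i \<and> k = j]"

definition broadcasts :: "nat \<Rightarrow> ('p, 'x) log \<Rightarrow> 'p list" where
  "broadcasts i l = [m. Input k (ABroadcast m) \<leftarrow> l, k = i]"

definition deliveries :: "nat \<Rightarrow> ('p, 'x) log \<Rightarrow> 'p list" where
  "deliveries i l = [m. Output k (ADeliver m) \<leftarrow> l, k = i]"

subsection \<open>Adversary and runs\<close>

text \<open>
  One adversary controls the application inputs, the network and the faulty processes. In every step
  it chooses an action, depending on everything that has happened so far except the tapes of the
  correct processes. \<open>Transmit i j\<close> hands the oldest pending message on the link from \<open>i\<close> to \<open>j\<close> to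
  process \<open>j\<close>. The reaction of a faulty process is chosen by \<open>misbehave\<close>, and the adversary may
  schedule such a process at any time, so it sends whatever and whenever it likes, always under its
  own identity.
\<close>

datatype 'p action =
    Invoke nat 'p
  | Transmit nat nat
  | Tick nat

record ('p, 'x, 'r) adversary =
  faulty :: "nat set"
  schedule :: "nat \<Rightarrow> ('p, 'x) log \<Rightarrow> (nat \<Rightarrow> 'r) \<Rightarrow> 'p action"
  misbehave :: "('p, 'x) log \<Rightarrow> (nat \<Rightarrow> 'r) \<Rightarrow> nat \<Rightarrow> ('p, 'x) reaction list"

fun triggered :: "('p, 'x) log \<Rightarrow> 'p action \<Rightarrow> (nat \<times> ('p, 'x) input) option" where
  "triggered l (Invoke i m) = Some (i, ABroadcast m)"
| "triggered l (Tick i) = Some (i, Internal)"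
| "triggered l (Transmit i j) =
     (case drop (length (received i j l)) (sent i j l) of
        [] \<Rightarrow> None
      | x # _ \<Rightarrow> Some (j, Receive i x))"

text \<open>
  Faulty processes pool their signing keys and see all network traffic, but they can use a signature
  of a correct process only after that process itself has issued it.
\<close>

fun unforged ::
  "('p, 'x, 'c, 'r) protocol \<Rightarrow> nat set \<Rightarrow> ('p, 'x) log \<Rightarrow> ('p, 'x) reaction \<Rightarrow> bool" where
  "unforged P F l (ADeliver m) = True"
| "unforged P F l (Send d x) =
     (\<forall>(j, c) \<in> signatures P x.
        j \<in> F \<or> (\<exists>d' y. Output j (Send d' y) \<in> set l \<and> (j, c) \<in> signatures P y))"

definition step ::
  "nat \<Rightarrow> ('p, 'x, 'c, 'r) protocol \<Rightarrow> ('p, 'x, 'r) adversary \<Rightarrow> (nat \<Rightarrow> 'r) \<Rightarrow>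
   nat \<Rightarrow> ('p, 'x) log \<Rightarrow> ('p, 'x) log" where
  "step n P A \<omega> t l =
     (let F = faulty A; \<omega>\<^sub>F = restrict \<omega> F in
      case triggered l (schedule A t l \<omega>\<^sub>F) of
        None \<Rightarrow> l
      | Some (i, a) \<Rightarrow>
          if i < n then
            (let l' = l @ [Input i a] in
             l' @ map (Output i)
               (if i \<in> F then filter (unforged P F l') (misbehave A l' \<omega>\<^sub>F i)
                else react P i (\<omega> i) (inputs i l')))
          else l)"

primrec run ::
  "nat \<Rightarrow> ('p, 'x, 'c, 'r) protocol \<Rightarrow> ('p, 'x, 'r) adversary \<Rightarrow> (nat \<Rightarrow> 'r) \<Rightarrow>
   nat \<Rightarrow> ('p, 'x) log" where
  "run n P A \<omega> 0 = []"
| "run n P A \<omega> (Suc t) = step n P A \<omega> t (run n P A \<omega> t)"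

definition correct :: "nat \<Rightarrow> ('p, 'x, 'r) adversary \<Rightarrow> nat set" where
  "correct n A = {..<n} - faulty A"

text \<open>
  A run is given by its growing sequence of logs \<open>L\<close>. Links lose no message between
  processes in \<open>C\<close>, and these processes never stop taking local steps; there is no bound on delays.
\<close>

definition reliable :: "nat set \<Rightarrow> (nat \<Rightarrow> ('p, 'x) log) \<Rightarrow> bool" where
  "reliable C L \<longleftrightarrow>
     (\<forall>i\<in>C. \<forall>j\<in>C. \<forall>t. \<exists>t'. length (sent i j (L t)) \<le> length (received i j (L t'))) \<and>
     (\<forall>i\<in>C. \<forall>k. \<exists>t. k \<le> length (filter (\<lambda>e. e = Input i Internal) (L t)))"

definition admissible ::
  "nat \<Rightarrow> nat \<Rightarrow> ('p, 'x, 'c, 'r) protocol \<Rightarrow> ('p, 'x, 'r) adversary \<Rightarrow> bool" where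
  "admissible n f P A \<longleftrightarrow>
     faulty A \<subseteq> {..<n} \<and> card (faulty A) \<le> f \<and>
     (\<forall>\<omega> \<in> space (coins P). reliable (correct n A) (run n P A \<omega>))"

subsection \<open>Atomic broadcast\<close>

definition a_broadcasts :: "(nat \<Rightarrow> ('p, 'x) log) \<Rightarrow> nat \<Rightarrow> 'p \<Rightarrow> bool" where
  "a_broadcasts L i m \<longleftrightarrow> (\<exists>t. m \<in> set (broadcasts i (L t)))"

definition a_delivers :: "(nat \<Rightarrow> ('p, 'x) log) \<Rightarrow> nat \<Rightarrow> 'p \<Rightarrow> bool" where
  "a_delivers L i m \<longleftrightarrow> (\<exists>t. m \<in> set (deliveries i (L t)))"

text \<open>If an element is repeated, its first occurrence counts.\<close>

definition precedes :: "'a list \<Rightarrow> 'a \<Rightarrow> 'a \<Rightarrow> bool" where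
  "precedes xs a b \<longleftrightarrow> (\<exists>ys zs. xs = ys @ a # zs \<and> b \<notin> set ys \<and> b \<in> set zs)"

definition broadcasts_before :: "(nat \<Rightarrow> ('p, 'x) log) \<Rightarrow> nat \<Rightarrow> 'p \<Rightarrow> 'p \<Rightarrow> bool" where
  "broadcasts_before L i m m' \<longleftrightarrow> (\<exists>t. precedes (broadcasts i (L t)) m m')"

definition delivers_before :: "(nat \<Rightarrow> ('p, 'x) log) \<Rightarrow> nat \<Rightarrow> 'p \<Rightarrow> 'p \<Rightarrow> bool" where
  "delivers_before L i m m' \<longleftrightarrow> (\<exists>t. precedes (deliveries i (L t)) m m')"

text \<open>Validity only concerns payloads that all correct processes a-broadcast.\<close>

definition validity :: "nat set \<Rightarrow> (nat \<Rightarrow> ('p, 'x) log) \<Rightarrow> bool" where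
  "validity C L \<longleftrightarrow> (\<forall>m. (\<forall>i\<in>C. a_broadcasts L i m) \<longrightarrow> (\<forall>i\<in>C. a_delivers L i m))"

definition no_duplication :: "nat set \<Rightarrow> (nat \<Rightarrow> ('p, 'x) log) \<Rightarrow> bool" where
  "no_duplication C L \<longleftrightarrow> (\<forall>i\<in>C. \<forall>t. distinct (deliveries i (L t)))"

definition agreement :: "nat set \<Rightarrow> (nat \<Rightarrow> ('p, 'x) log) \<Rightarrow> bool" where
  "agreement C L \<longleftrightarrow> (\<forall>m. (\<exists>i\<in>C. a_delivers L i m) \<longrightarrow> (\<forall>j\<in>C. a_delivers L j m))"

definition total_order :: "nat set \<Rightarrow> (nat \<Rightarrow> ('p, 'x) log) \<Rightarrow> bool" where
  "total_order C L \<longleftrightarrow>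
     (\<forall>i\<in>C. \<forall>j\<in>C. \<forall>m m'.
        a_delivers L i m \<longrightarrow> a_delivers L i m' \<longrightarrow> a_delivers L j m \<longrightarrow> a_delivers L j m' \<longrightarrow>
        delivers_before L i m m' \<longrightarrow> delivers_before L j m m')"

text \<open>
  Since protocols may be randomised, all properties are required with probability one, for every
  admissible adversary.
\<close>

definition atomic_broadcast :: "nat \<Rightarrow> nat \<Rightarrow> ('p, 'x, 'c, 'r) protocol \<Rightarrow> bool" where
  "atomic_broadcast n f P \<longleftrightarrow>
     (\<forall>A. admissible n f P A \<longrightarrow>
        (AE \<omega> in coins P. validity (correct n A) (run n P A \<omega>) \<and>
                          no_duplication (correct n A) (run n P A \<omega>) \<and>
                          agreement (correct n A) (run n P A \<omega>) \<and>
                          total_order (correct n A) (run n P A \<omega>)))"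

subsection \<open>Order fairness\<close>

definition num_before :: "nat set \<Rightarrow> (nat \<Rightarrow> ('p, 'x) log) \<Rightarrow> 'p \<Rightarrow> 'p \<Rightarrow> nat" where
  "num_before C L m m' = card {i \<in> C. broadcasts_before L i m m'}"

definition order_fair :: "real \<Rightarrow> nat set \<Rightarrow> (nat \<Rightarrow> ('p, 'x) log) \<Rightarrow> bool" where
  "order_fair \<mu> C L \<longleftrightarrow>
     (\<forall>m m'. (\<forall>i\<in>C. a_broadcasts L i m \<and> a_broadcasts L i m') \<longrightarrow>
        real (num_before C L m m') > real (num_before C L m' m) + \<mu> \<longrightarrow>
        (\<forall>i\<in>C. \<not> delivers_before L i m' m))"

text \<open>
  The convention behind \<open>b(m,m')\<close> (\<open>num_before\<close>) is that there are exactly \<open>n - f\<close> correct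
  processes, so that \<open>b(m,m') + b(m',m) = n - f\<close>; faulty processes may follow the protocol. Order
  fairness is therefore only asked of adversaries that corrupt exactly \<open>f\<close> processes. Asking it of
  all admissible adversaries would be a stronger requirement on the protocol.
\<close>

definition weak_differential_order_fairness ::
  "nat \<Rightarrow> nat \<Rightarrow> real \<Rightarrow> ('p, 'x, 'c, 'r) protocol \<Rightarrow> bool" where
  "weak_differential_order_fairness n f \<mu> P \<longleftrightarrow>
     (\<forall>A. admissible n f P A \<longrightarrow> card (faulty A) = f \<longrightarrow>
        (AE \<omega> in coins P. order_fair \<mu> (correct n A) (run n P A \<omega>)))"

end

theory Submission
  imports Defs
begin

text \<open>
  For \<open>f > 0\<close>, let all \<open>n\<close> processes follow the protocol, process \<open>p\<close> broadcasting the payloads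
  \<open>g p, g (p + 1), \<dots>, g (p + n - 1)\<close> with indices modulo \<open>n\<close>. Only process \<open>i + 1\<close> broadcasts
  \<open>g (i + 1)\<close> before \<open>g i\<close>. The same run arises from an adversary that has corrupted \<open>f\<close> processes
  including \<open>i + 1\<close>, all of which behave honestly; then the \<open>n - f > 2 f\<close> correct processes
  are unanimous, so if \<open>\<mu> < 2 f\<close>, fairness forbids them to deliver \<open>g (i + 1)\<close> before \<open>g i\<close>. By total
  order in the adversary without faults, the delivery order is the same everywhere, and it would
  have to be cyclic.
\<close>

section \<open>Projections of logs and growth of runs\<close>

lemma inputs_append [simp]: "inputs i (l @ l') = inputs i l @ inputs i l'"
  and sent_append [simp]: "sent i j (l @ l') = sent i j l @ sent i j l'"
  and received_append [simp]: "received i j (l @ l') = received i j l @ received i j l'"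
  and broadcasts_append [simp]: "broadcasts i (l @ l') = broadcasts i l @ broadcasts i l'"
  and deliveries_append [simp]: "deliveries i (l @ l') = deliveries i l @ deliveries i l'"
  by (simp_all add: inputs_def sent_def received_def broadcasts_def deliveries_def)

lemma received_outputs [simp]: "received i j (map (Output k) os) = []"
  and broadcasts_outputs [simp]: "broadcasts i (map (Output k) os) = []"
  by (induction os) (simp_all add: received_def broadcasts_def)

lemma broadcasts_Nil [simp]: "broadcasts i [] = []"
  by (simp add: broadcasts_def)

lemma received_input [simp]:
  "received i j (Input k a # l) =
     (case a of Receive s x \<Rightarrow> if s = i \<and> k = j then [x] else [] | _ \<Rightarrow> []) @ received i j l"
  by (simp add: received_def split: input.splits)

lemma broadcasts_input [simp]:
  "broadcasts i (Input k a # l) =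
     (case a of ABroadcast m \<Rightarrow> if k = i then [m] else [] | _ \<Rightarrow> []) @ broadcasts i l"
  by (simp add: broadcasts_def split: input.splits)

lemma set_inputs: "a \<in> set (inputs i l) \<longleftrightarrow> Input i a \<in> set l"
  by (induction l) (auto simp: inputs_def split: event.splits)

lemma set_sent: "x \<in> set (sent i j l) \<longleftrightarrow> Output i (Send j x) \<in> set l"
  by (induction l) (auto simp: sent_def split: event.splits reaction.splits)

lemma step_extends: "\<exists>l'. step n P A \<omega> t l = l @ l'"
  by (auto simp: step_def Let_def split: option.splits)

lemma run_extends: "t \<le> t' \<Longrightarrow> \<exists>l'. run n P A \<omega> t' = run n P A \<omega> t @ l'"
proof (induction t' rule: dec_induct)
  case (step t')
  then show ?case using step_extends[of n P A \<omega> t' "run n P A \<omega> t'"] by auto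
qed simp

section \<open>Faulty processes that follow the protocol\<close>

text \<open>The schedule depends on the time alone, so that one schedule serves for every
  \<open>F\<close>. Replaying \<open>react\<close> is open to the adversary because it sees the
  tapes of the faulty processes.\<close>

definition honest_adversary ::
  "('p, 'x, 'c, 'r) protocol \<Rightarrow> (nat \<Rightarrow> 'p action) \<Rightarrow> nat set \<Rightarrow> ('p, 'x, 'r) adversary" where
  "honest_adversary P s F =
     \<lparr>faulty = F, schedule = \<lambda>t l \<omega>. s t, misbehave = \<lambda>l \<omega> i. react P i (\<omega> i) (inputs i l)\<rparr>"

lemma faulty_honest_adversary [simp]: "faulty (honest_adversary P s F) = F"
  by (simp add: honest_adversary_def)

abbreviation honest_run ::
  "nat \<Rightarrow> ('p, 'x, 'c, 'r) protocol \<Rightarrow> (nat \<Rightarrow> 'p action) \<Rightarrow> (nat \<Rightarrow> 'r) \<Rightarrow> nat \<Rightarrow> ('p, 'x) log" where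
  "honest_run n P s \<omega> \<equiv> run n P (honest_adversary P s {}) \<omega>"

text \<open>\<open>misbehave\<close> reads only the tape of the acting process, which lies in
  \<open>F\<close>, so restricting the tapes is harmless. The filter is then the only trace of
  \<open>F\<close>.\<close>

lemma step_honest_adversary:
  "step n P (honest_adversary P s F) \<omega> t l =
     (case triggered l (s t) of
        None \<Rightarrow> l
      | Some (i, a) \<Rightarrow>
          if i < n then
            (let l' = l @ [Input i a]; os = react P i (\<omega> i) (inputs i l') in
             l' @ map (Output i) (if i \<in> F then filter (unforged P F l') os else os))
          else l)"
  by (auto simp: step_def honest_adversary_def Let_def split: option.splits)

text \<open>The invariant behind the absence of forgeries in honest runs; its second clause ends
  with what \<open>unforged\<close> tests for signers outside \<open>F\<close>.\<close>

definition authentic :: "('p, 'x, 'c, 'r) protocol \<Rightarrow> ('p, 'x) log \<Rightarrow> bool" where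
  "authentic P l \<longleftrightarrow>
     (\<forall>i k x. Input i (Receive k x) \<in> set l \<longrightarrow> Output k (Send i x) \<in> set l) \<and>
     (\<forall>k d x j c. Output k (Send d x) \<in> set l \<longrightarrow> (j, c) \<in> signatures P x \<longrightarrow>
        (\<exists>d' y. Output j (Send d' y) \<in> set l \<and> (j, c) \<in> signatures P y))"

lemma triggered_receive:
  assumes "triggered l act = Some (i, Receive k x)"
  shows "Output k (Send i x) \<in> set l"
proof (cases act)
  case (Transmit a b)
  with assms have "x \<in> set (sent k i l)"
    by (auto split: list.splits dest!: arg_cong[where f = set] intro: in_set_dropD)
  then show ?thesis by (simp add: set_sent)
qed (use assms in auto)

text \<open>By \<open>well_formed\<close>, a foreign signature stems from a received message; that
  message was sent before, and the invariant leads from there to the signer.\<close>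

lemma signature_origin:
  assumes "well_formed n P" and auth: "authentic P l" and trig: "triggered l act = Some (i, a)"
    and "i < n" and out: "Send d x \<in> set (react P i r (inputs i (l @ [Input i a])))"
    and sig: "(j, c) \<in> signatures P x" and "j \<noteq> i"
  shows "\<exists>d' y. Output j (Send d' y) \<in> set l \<and> (j, c) \<in> signatures P y"
proof -
  from assms obtain k y where "Receive k y \<in> set (inputs i (l @ [Input i a]))"
    and y: "(j, c) \<in> signatures P y"
    unfolding well_formed_def by blast
  \<comment> \<open>The message may be the current input, not yet recorded in \<open>l\<close>;
    \<open>triggered_receive\<close> covers this case.\<close>
  then have "Input i (Receive k y) \<in> set l \<or> a = Receive k y"
    by (auto simp: set_inputs simp del: inputs_append)
  then have "Output k (Send i y) \<in> set l"
    using auth trig triggered_receive unfolding authentic_def by fastforce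
  with y auth show ?thesis
    unfolding authentic_def by blast
qed

lemma authentic_step:
  assumes "well_formed n P" and auth: "authentic P l"
  shows "authentic P (step n P (honest_adversary P s {}) \<omega> t l)"
proof (cases "triggered l (s t)")
  case None
  with auth show ?thesis by (simp add: step_honest_adversary)
next
  case (Some ia)
  obtain i a where ia: "ia = (i, a)" by fastforce
  show ?thesis
  proof (cases "i < n")
    case False
    with auth Some ia show ?thesis by (simp add: step_honest_adversary)
  next
    case True
    note origin = signature_origin[OF assms Some[unfolded ia] True]
    show ?thesis
      unfolding authentic_def
    proof (intro conjI allI impI)
      fix j k x
      assume "Input j (Receive k x) \<in> set (step n P (honest_adversary P s {}) \<omega> t l)"
      then have "Input j (Receive k x) \<in> set l \<or> i = j \<and> a = Receive k x"
        using Some ia True by (auto simp: step_honest_adversary Let_def)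
      then have "Output k (Send j x) \<in> set l"
        using auth Some ia triggered_receive unfolding authentic_def by fastforce
      then show "Output k (Send j x) \<in> set (step n P (honest_adversary P s {}) \<omega> t l)"
        using Some ia True by (simp add: step_honest_adversary Let_def)
    next
      fix k d x j c
      assume out: "Output k (Send d x) \<in> set (step n P (honest_adversary P s {}) \<omega> t l)"
        and sig: "(j, c) \<in> signatures P x"
      show "\<exists>d' y. Output j (Send d' y) \<in> set (step n P (honest_adversary P s {}) \<omega> t l) \<and>
              (j, c) \<in> signatures P y"
      \<comment> \<open>A signature of the sender itself is witnessed by the message at
        hand.\<close>
      proof (cases "j = k")
        case True
        with out sig show ?thesis by blast
      next
        case False
        from out have "Output k (Send d x) \<in> set l \<or>
            k = i \<and> Send d x \<in> set (react P i (\<omega> i) (inputs i (l @ [Input i a])))"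
          using Some ia True by (auto simp: step_honest_adversary Let_def)
        then have "\<exists>d' y. Output j (Send d' y) \<in> set l \<and> (j, c) \<in> signatures P y"
          using origin sig False auth unfolding authentic_def by blast
        then show ?thesis
          using Some ia True by (auto simp: step_honest_adversary Let_def)
      qed
    qed
  qed
qed

lemma authentic_honest_run: "well_formed n P \<Longrightarrow> authentic P (honest_run n P s \<omega> t)"
  by (induction t) (simp add: authentic_def, simp add: authentic_step)

text \<open>Honest messages only carry signatures that were issued before, so none of them is filtered out.\<close>

lemma run_honest_adversary:
  assumes "well_formed n P"
  shows "run n P (honest_adversary P s F) \<omega> t = honest_run n P s \<omega> t"
proof (induction t)
  case (Suc t)
  define l where "l = honest_run n P s \<omega> t"
  have auth: "authentic P l"
    unfolding l_def using assms by (rule authentic_honest_run)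
  have "filter (unforged P F (l @ [Input i a])) (react P i (\<omega> i) (inputs i (l @ [Input i a]))) =
      react P i (\<omega> i) (inputs i (l @ [Input i a]))"
    if trig: "triggered l (s t) = Some (i, a)" and i: "i < n" "i \<in> F" for i a
  proof (rule filter_True, rule ballI)
    fix q
    assume q: "q \<in> set (react P i (\<omega> i) (inputs i (l @ [Input i a])))"
    show "unforged P F (l @ [Input i a]) q"
    proof (cases q)
      case (Send d x)
      \<comment> \<open>Own signatures of \<open>i\<close> pass because \<open>i\<close> is in
        \<open>F\<close>; foreign ones are traced back to \<open>l\<close>.\<close>
      with q signature_origin[OF assms auth trig i(1)] i(2) show ?thesis by fastforce
    qed simp
  qed
  then have "step n P (honest_adversary P s F) \<omega> t l = step n P (honest_adversary P s {}) \<omega> t l"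
    by (auto simp: step_honest_adversary Let_def split: option.splits)
  with Suc show ?case by (simp add: l_def)
qed simp

section \<open>Fair schedules\<close>

text \<open>Fairness concerns the schedule alone, so it yields reliability for all tapes at once, as
  \<open>admissible\<close> demands.\<close>

definition fair :: "(nat \<Rightarrow> 'p action) \<Rightarrow> bool" where
  "fair s \<longleftrightarrow> (\<forall>t i j. (\<exists>t'\<ge>t. s t' = Tick i) \<and> (\<exists>t'\<ge>t. s t' = Transmit i j))"

lemma received_mono:
  "t \<le> t' \<Longrightarrow> length (received i j (run n P A \<omega> t)) \<le> length (received i j (run n P A \<omega> t'))"
  by (drule run_extends[of t t' n P A \<omega>]) auto

lemma reliable_honest_run:
  assumes "fair s"
  shows "reliable ({..<n} - F) (honest_run n P s \<omega>)"
  unfolding reliable_def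
proof (intro conjI ballI allI)
  let ?L = "honest_run n P s \<omega>"
  fix i j t
  assume j: "j \<in> {..<n} - F"
  \<comment> \<open>Messages arrive one per \<open>Transmit i j\<close>, hence the induction on
    \<open>k\<close>; \<open>t' \<ge> t\<close> keeps the messages sent by time \<open>t\<close> in
    the log.\<close>
  have "\<exists>t'\<ge>t. k \<le> length (received i j (?L t'))" if "k \<le> length (sent i j (?L t))" for k
    using that
  proof (induction k)
    case (Suc k)
    then obtain t1 where t1: "t1 \<ge> t" "k \<le> length (received i j (?L t1))" by auto
    obtain t2 where t2: "t2 \<ge> t1" "s t2 = Transmit i j"
      using assms unfolding fair_def by blast
    have "k \<le> length (received i j (?L t2))"
      using t1 received_mono[OF t2(1)] le_trans by blast
    \<comment> \<open>If more than \<open>k\<close> messages have arrived by \<open>t2\<close>,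
      monotonicity suffices; otherwise one is still pending and gets transmitted.\<close>
    moreover have "Suc k \<le> length (received i j (?L (Suc t2)))"
      if k: "length (received i j (?L t2)) = k"
    proof -
      have "t \<le> t2" using t1 t2 by simp
      then obtain l' where "?L t2 = ?L t @ l'" using run_extends by blast
      then have "drop k (sent i j (?L t2)) \<noteq> []" using Suc.prems by simp
      then obtain x xs where "drop k (sent i j (?L t2)) = x # xs" by (meson list.exhaust)
      with k j t2 show ?thesis by (simp add: step_honest_adversary Let_def)
    qed
    ultimately have "Suc k \<le> length (received i j (?L (Suc t2)))"
      using received_mono[of t2 "Suc t2" i j n P "honest_adversary P s {}" \<omega>] by linarith
    then show ?case using t1 t2 by (meson le_SucI le_trans)
  qed auto
  then show "\<exists>t'. length (sent i j (?L t)) \<le> length (received i j (?L t'))" by blast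
next
  let ?L = "honest_run n P s \<omega>"
  fix i k
  assume i: "i \<in> {..<n} - F"
  show "\<exists>t. k \<le> length (filter (\<lambda>e. e = Input i Internal) (?L t))"
  proof (induction k)
    case (Suc k)
    then obtain t1 where t1: "k \<le> length (filter (\<lambda>e. e = Input i Internal) (?L t1))" by blast
    obtain t2 where t2: "t2 \<ge> t1" "s t2 = Tick i"
      using assms unfolding fair_def by blast
    then obtain l' where "?L t2 = ?L t1 @ l'" using run_extends by blast
    with t1 t2 i have "Suc k \<le> length (filter (\<lambda>e. e = Input i Internal) (?L (Suc t2)))"
      by (simp add: step_honest_adversary Let_def)
    then show ?case by blast
  qed simp
qed

lemma admissible_honest_adversary:
  assumes "well_formed n P" "fair s" "F \<subseteq> {..<n}" "card F \<le> f"
  shows "admissible n f P (honest_adversary P s F)"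
proof -
  have "run n P (honest_adversary P s F) \<omega> = honest_run n P s \<omega>" for \<omega>
    using run_honest_adversary[OF assms(1)] by blast
  then show ?thesis
    using assms by (simp add: admissible_def correct_def reliable_honest_run)
qed

text \<open>An invocation at a process below \<open>n\<close> always takes effect, and no other
  action triggers \<open>ABroadcast\<close>.\<close>

lemma broadcasts_honest_run:
  assumes "p < n"
  shows "broadcasts p (honest_run n P s \<omega> t) = [m. Invoke k m \<leftarrow> map s [0..<t], k = p]"
proof (induction t)
  case (Suc t)
  then show ?case
    using assms by (cases "s t") (auto simp: step_honest_adversary Let_def split: list.splits)
qed simp

text \<open>After the invocations, \<open>t\<close> is read as a code of a triple. Its first
  component is ignored, so that every action recurs infinitely often; in the second,
  \<open>0\<close> stands for a tick and \<open>Suc j\<close> for a transmission to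
  \<open>j\<close>.\<close>

definition invoke_then_idle :: "nat \<Rightarrow> (nat \<Rightarrow> 'p list) \<Rightarrow> nat \<Rightarrow> 'p action" where
  "invoke_then_idle n xs t =
     (let invocations = concat (map (\<lambda>i. map (Invoke i) (xs i)) [0..<n]) in
      if t < length invocations then invocations ! t
      else case prod_decode (snd (prod_decode t)) of
        (0, i) \<Rightarrow> Tick i
      | (Suc j, i) \<Rightarrow> Transmit i j)"

lemma fair_invoke_then_idle: "fair (invoke_then_idle n xs)"
proof -
  define K where "K = length (concat (map (\<lambda>i. map (Invoke i) (xs i)) [0..<n]))"
  have idle: "\<exists>t'\<ge>t. invoke_then_idle n xs t' =
      (case (a, i) of (0, i) \<Rightarrow> Tick i | (Suc j, i) \<Rightarrow> Transmit i j)" for t a i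
  proof (intro exI conjI)
    \<comment> \<open>A code is at least its first component, so this time lies beyond both
      \<open>t\<close> and the \<open>K\<close> invocations.\<close>
    let ?t = "prod_encode (t + K, prod_encode (a, i))"
    have "?t \<ge> t + K" by (rule le_prod_encode_1)
    then show "?t \<ge> t" by simp
    from \<open>?t \<ge> t + K\<close> show "invoke_then_idle n xs ?t =
        (case (a, i) of (0, i) \<Rightarrow> Tick i | (Suc j, i) \<Rightarrow> Transmit i j)"
      by (simp add: invoke_then_idle_def K_def Let_def)
  qed
  show ?thesis
    unfolding fair_def
  proof (intro allI conjI)
    fix t i j
    show "\<exists>t'\<ge>t. invoke_then_idle n xs t' = Tick i" using idle[of t 0 i] by simp
    show "\<exists>t'\<ge>t. invoke_then_idle n xs t' = Transmit i j" using idle[of t "Suc j" i] by simp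
  qed
qed

lemma broadcasts_invoke_then_idle:
  assumes "p < n"
  shows "\<exists>t\<^sub>0. \<forall>t\<ge>t\<^sub>0. broadcasts p (honest_run n P (invoke_then_idle n xs) \<omega> t) = xs p"
proof -
  let ?L = "honest_run n P (invoke_then_idle n xs) \<omega>"
  define invs where "invs = concat (map (\<lambda>i. map (Invoke i) (xs i)) [0..<n])"
  \<comment> \<open>The conditional makes the claim inductive in \<open>n\<close>: only the block of
    \<open>p\<close> contributes.\<close>
  have "[m. Invoke k m \<leftarrow> invs, k = p] = (if p < n then xs p else [])"
    unfolding invs_def
  proof (induction n)
    case (Suc n)
    have "[m. Invoke k m \<leftarrow> map (Invoke i) ys, k = p] = (if i = p then ys else [])" for i and ys :: "'a list"
      by (induction ys) auto
    with Suc show ?case by (auto simp: less_Suc_eq)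
  qed simp
  moreover have "map (invoke_then_idle n xs) [0..<length invs] = invs"
    by (rule nth_equalityI) (simp_all add: invoke_then_idle_def invs_def Let_def)
  ultimately have 1: "broadcasts p (?L (length invs)) = xs p"
    using assms by (simp only: broadcasts_honest_run) auto
  have "broadcasts p (?L t) = xs p" if "t \<ge> length invs" for t
    using that
  proof (induction t rule: dec_induct)
    case (step t)
    then have "invoke_then_idle n xs t \<noteq> Invoke k m" for k m
      by (auto simp: invoke_then_idle_def invs_def Let_def split: nat.splits prod.splits)
    then have "broadcasts p (?L (Suc t)) = broadcasts p (?L t)"
      unfolding broadcasts_honest_run[OF assms] by (cases "invoke_then_idle n xs t") auto
    with step show ?case by simp
  qed (fact 1)
  then show ?thesis by blast
qed

section \<open>Precedence\<close>

lemma precedes_append: "precedes xs a b \<Longrightarrow> precedes (xs @ ys) a b"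
  unfolding precedes_def by fastforce

lemma precedes_nth:
  assumes "distinct xs" "i < j" "j < length xs"
  shows "precedes xs (xs ! i) (xs ! j)"
proof -
  have "xs = take i xs @ xs ! i # drop (Suc i) xs"
    using assms by (intro id_take_nth_drop) simp
  moreover have "xs ! j \<notin> set (take i xs)"
    using assms by (auto simp: in_set_conv_nth nth_eq_iff_index_eq)
  moreover have "xs ! j \<in> set (drop (Suc i) xs)"
    using assms by (auto simp: in_set_conv_nth intro!: exI[of _ "j - Suc i"])
  ultimately show ?thesis unfolding precedes_def by blast
qed

lemma precedes_nthD:
  assumes "precedes xs a b"
  shows "\<exists>i j. i < j \<and> j < length xs \<and> xs ! i = a \<and> xs ! j = b"
proof -
  obtain ys zs where xs: "xs = ys @ a # zs" "b \<in> set zs"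
    using assms unfolding precedes_def by blast
  then obtain k where "k < length zs" "zs ! k = b" by (auto simp: in_set_conv_nth)
  with xs show ?thesis
    by (intro exI[of _ "length ys"] exI[of _ "length ys + Suc k"]) (simp add: nth_append)
qed

lemma precedes_asym: "distinct xs \<Longrightarrow> precedes xs a b \<Longrightarrow> \<not> precedes xs b a"
  by (auto dest!: precedes_nthD simp: nth_eq_iff_index_eq)

text \<open>Precedence survives extension of a list, so a witnessing time can be moved to where the
  list has stabilised.\<close>

lemma broadcasts_before_iff:
  assumes "\<forall>t\<ge>t\<^sub>0. broadcasts p (run n P A \<omega> t) = xs"
  shows "broadcasts_before (run n P A \<omega>) p a b \<longleftrightarrow> precedes xs a b"
proof
  assume "broadcasts_before (run n P A \<omega>) p a b"
  then obtain t where t: "precedes (broadcasts p (run n P A \<omega> t)) a b"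
    unfolding broadcasts_before_def by blast
  obtain l where "run n P A \<omega> (max t t\<^sub>0) = run n P A \<omega> t @ l"
    using run_extends max.cobounded1 by blast
  then show "precedes xs a b"
    using t assms precedes_append by (metis broadcasts_append max.cobounded2)
next
  assume "precedes xs a b"
  with assms show "broadcasts_before (run n P A \<omega>) p a b"
    unfolding broadcasts_before_def by blast
qed

text \<open>Take the \<open>g i\<close> whose position in \<open>D\<close> is largest: its cyclic
  successor differs from it, as \<open>2 \<le> n\<close>, and so comes earlier.\<close>

lemma cyclic_successor_not_total:
  assumes "distinct D" "2 \<le> n" "inj_on g {..<n}" "g ` {..<n} \<subseteq> set D"
  shows "\<exists>i<n. precedes D (g (Suc i mod n)) (g i)"
proof -
  have "\<forall>i<n. \<exists>k<length D. D ! k = g i"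
    using assms(4) by (auto simp: in_set_conv_nth image_subset_iff)
  then obtain pos where pos: "\<And>i. i < n \<Longrightarrow> pos i < length D \<and> D ! pos i = g i" by metis
  have "finite (pos ` {..<n})" "pos ` {..<n} \<noteq> {}"
    using assms(2) by (auto simp: lessThan_empty_iff)
  from Max_in[OF this] obtain i where i: "i < n" and max: "\<And>j. j < n \<Longrightarrow> pos j \<le> pos i"
    using Max_ge[of "pos ` {..<n}"] by (metis (mono_tags, lifting) \<open>finite (pos ` {..<n})\<close> imageE imageI lessThan_iff)
  let ?j = "Suc i mod n"
  have j: "?j < n" "?j \<noteq> i"
    using assms(2) i by (auto simp: mod_Suc)
  then have "g ?j \<noteq> g i" using assms(3) i by (auto dest: inj_onD)
  then have "pos ?j \<noteq> pos i" using pos i j by metis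
  then have "pos ?j < pos i" using max j by (simp add: le_neq_implies_less)
  then have "precedes D (g ?j) (g i)"
    using precedes_nth[OF assms(1)] pos i j by metis
  with i show ?thesis by blast
qed

text \<open>Rotation keeps cyclic neighbours adjacent except at the cut in front of index
  \<open>p\<close>, which the last assumption excludes.\<close>

lemma precedes_rotate:
  fixes xs :: "'a list"
  defines "n \<equiv> length xs"
  assumes "distinct xs" "p < n" "i < n" "p \<noteq> Suc i mod n"
  shows "precedes (rotate p xs) (xs ! i) (xs ! (Suc i mod n))"
proof -
  \<comment> \<open>The position of \<open>xs ! i\<close> in \<open>rotate p xs\<close>; away from
    the cut it is not the last one.\<close>
  define k where "k = (if p \<le> i then i - p else i + n - p)"
  have k: "Suc k < n" "(p + k) mod n = i"
    using assms(3-5) by (auto simp: k_def mod_Suc split: if_splits)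
  moreover from k(2) have "(p + Suc k) mod n = Suc i mod n"
    by (metis add_Suc_right mod_Suc_eq)
  moreover have "precedes (rotate p xs) (rotate p xs ! k) (rotate p xs ! Suc k)"
    using assms(2) k(1) by (intro precedes_nth) (simp_all add: n_def)
  ultimately show ?thesis
    by (simp add: nth_rotate n_def)
qed

section \<open>A Condorcet cycle\<close>

text \<open>Logs only grow, so the maximum of finitely many delivery times serves for all
  payloads.\<close>

lemma deliveries_contain_finite:
  assumes "finite M" "\<forall>m\<in>M. a_delivers (run n P A \<omega>) p m"
  shows "\<exists>t. M \<subseteq> set (deliveries p (run n P A \<omega> t))"
  using assms
proof induction
  case (insert m M)
  then obtain t t' where t: "M \<subseteq> set (deliveries p (run n P A \<omega> t))"
      "m \<in> set (deliveries p (run n P A \<omega> t'))"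
    unfolding a_delivers_def by auto
  obtain l where "run n P A \<omega> (max t t') = run n P A \<omega> t @ l"
    using run_extends[OF max.cobounded1] by blast
  moreover obtain l' where "run n P A \<omega> (max t t') = run n P A \<omega> t' @ l'"
    using run_extends[OF max.cobounded2] by blast
  moreover have "M \<subseteq> set (deliveries p (run n P A \<omega> t @ l))"
    "m \<in> set (deliveries p (run n P A \<omega> t' @ l'))"
    using t by auto
  ultimately have "insert m M \<subseteq> set (deliveries p (run n P A \<omega> (max t t')))"
    by (simp only: insert_subset)
  then show ?case by blast
qed simp

theorem theorem4:
  fixes n f :: nat
    and \<mu> :: real
    and P :: "('p::infinite, 'x, 'c, 'r) protocol"
  assumes "n > 3 * f"
    and "\<mu> \<ge> 0"
    and "well_formed n P"
    and "atomic_broadcast n f P"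
    and "weak_differential_order_fairness n f \<mu> P"
  shows "\<mu> \<ge> 2 * real f"
proof (rule ccontr)
  assume "\<not> \<mu> \<ge> 2 * real f"
  \<comment> \<open>Since \<open>0 \<le> \<mu> < 2 f\<close>, \<open>f\<close> is positive;
    \<open>n > 3 f\<close> makes the unanimous margin \<open>n - f\<close> exceed \<open>2 f\<close>
    and hence \<mu>.\<close>
  with assms have \<mu>: "\<mu> < real (n - f)" and f: "f > 0" "2 \<le> n"
    by (auto simp: of_nat_diff)
  obtain g :: "nat \<Rightarrow> 'p" where g: "inj g"
    using infinite_countable_subset[OF infinite_UNIV] by blast
  define shift where "shift p = rotate p (map g [0..<n])" for p
  have shift: "set (shift p) = g ` {..<n}" "distinct (shift p)" for p
    using g by (auto simp: shift_def distinct_map inj_on_def inj_def)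
  define s where "s = invoke_then_idle n shift"
  let ?A = "honest_adversary P s" and ?L = "honest_run n P s"
  have "fair s" unfolding s_def by (rule fair_invoke_then_idle)
  note adm = admissible_honest_adversary[OF assms(3) this]
  have run_eq: "run n P (?A F) \<omega> = ?L \<omega>" for F \<omega>
    using run_honest_adversary[OF assms(3)] by blast
  \<comment> \<open>The corrupted set removes the only dissenter about \<open>g i\<close> and
    \<open>g (Suc i mod n)\<close>; it is padded to size \<open>f\<close>, since fairness is only
    asked for exactly \<open>f\<close> faults.\<close>
  have "\<exists>F. Suc i mod n \<in> F \<and> F \<subseteq> {..<n} \<and> card F = f" for i
  proof -
    have "f - 1 \<le> card ({..<n} - {Suc i mod n})" using assms(1) f by simp
    then obtain G where G: "G \<subseteq> {..<n} - {Suc i mod n}" "card G = f - 1" "finite G"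
      by (rule obtain_subset_with_card_n)
    moreover from G(1) have "Suc i mod n \<notin> G" by blast
    ultimately have "card (insert (Suc i mod n) G) = f" using f by simp
    with G f show ?thesis by (intro exI[of _ "insert (Suc i mod n) G"]) auto
  qed
  then obtain F where F: "\<And>i. Suc i mod n \<in> F i" "\<And>i. F i \<subseteq> {..<n}" "\<And>i. card (F i) = f"
    by metis
  have "AE \<omega> in coins P. order_fair \<mu> ({..<n} - F i) (?L \<omega>)" for i
    using assms(5) adm[OF F(2), of i f] F(3)[of i]
    unfolding weak_differential_order_fairness_def
    by (fastforce simp: run_eq[of "F i"] correct_def)
  \<comment> \<open>Different \<open>i\<close> mean different adversaries but the same run, so
    countably many almost sure events can be intersected.\<close>
  then have "AE \<omega> in coins P. \<forall>i. order_fair \<mu> ({..<n} - F i) (?L \<omega>)"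
    by (simp add: AE_all_countable)
  \<comment> \<open>With no corruption all \<open>n\<close> processes count as correct, so total
    order also relates members of different sets \<open>F i\<close>.\<close>
  moreover have "AE \<omega> in coins P. validity {..<n} (?L \<omega>) \<and> no_duplication {..<n} (?L \<omega>) \<and>
      agreement {..<n} (?L \<omega>) \<and> total_order {..<n} (?L \<omega>)"
    using assms(4) adm[of "{}" f] unfolding atomic_broadcast_def by (fastforce simp: correct_def)
  ultimately have "AE \<omega> in coins P. (\<forall>i. order_fair \<mu> ({..<n} - F i) (?L \<omega>)) \<and>
      validity {..<n} (?L \<omega>) \<and> no_duplication {..<n} (?L \<omega>) \<and> total_order {..<n} (?L \<omega>)"
    by eventually_elim blast
  \<comment> \<open>In a probability space an almost sure property has a witness, so one tape
    assignment satisfies everything at once.\<close>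
  moreover have "ae_filter (coins P) \<noteq> bot"
    using assms(3) by (intro prob_space.ae_filter_bot) (simp add: well_formed_def)
  ultimately obtain \<omega> where fair: "\<And>i. order_fair \<mu> ({..<n} - F i) (?L \<omega>)"
    and valid: "validity {..<n} (?L \<omega>)" and nodup: "no_duplication {..<n} (?L \<omega>)"
    and total: "total_order {..<n} (?L \<omega>)"
    using eventually_happens'[of "ae_filter (coins P)"] by fast
  have bc: "\<exists>t\<^sub>0. \<forall>t\<ge>t\<^sub>0. broadcasts p (?L \<omega> t) = shift p" if "p < n" for p
    unfolding s_def using broadcasts_invoke_then_idle[OF that, where xs = shift] .
  have before: "broadcasts_before (?L \<omega>) p a b \<longleftrightarrow> precedes (shift p) a b"
    if "p < n" for p a b
    using bc[OF that] by (auto dest: broadcasts_before_iff)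
  have all: "a_broadcasts (?L \<omega>) p (g i)" if pi: "p < n" "i < n" for p i
  proof -
    obtain t\<^sub>0 where "broadcasts p (?L \<omega> t\<^sub>0) = shift p"
      using bc[OF pi(1)] by blast
    then have "g i \<in> set (broadcasts p (?L \<omega> t\<^sub>0))"
      using pi(2) by (simp add: shift(1))
    then show ?thesis unfolding a_broadcasts_def by blast
  qed
  then have deliver: "a_delivers (?L \<omega>) p (g i)" if "p < n" "i < n" for p i
    using valid that unfolding validity_def by auto
  have "\<not> delivers_before (?L \<omega>) 0 (g (Suc i mod n)) (g i)" if i: "i < n" for i
  proof
    assume rev: "delivers_before (?L \<omega>) 0 (g (Suc i mod n)) (g i)"
    have j: "Suc i mod n < n" using f by simp
    let ?C = "{..<n} - F i"
    have C: "broadcasts_before (?L \<omega>) p (g i) (g (Suc i mod n))"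
        "\<not> broadcasts_before (?L \<omega>) p (g (Suc i mod n)) (g i)" if "p \<in> ?C" for p
    proof -
      from that have "p < n" by simp
      moreover have "p \<noteq> Suc i mod n" using that F(1)[of i] by auto
      ultimately have prec: "precedes (shift p) (g i) (g (Suc i mod n))"
        using precedes_rotate[of "map g [0..<n]" p i] shift(2)[of 0] i j by (simp add: shift_def)
      show "broadcasts_before (?L \<omega>) p (g i) (g (Suc i mod n))"
        using prec by (simp only: before[OF \<open>p < n\<close>])
      show "\<not> broadcasts_before (?L \<omega>) p (g (Suc i mod n)) (g i)"
        using precedes_asym[OF shift(2) prec] by (simp only: before[OF \<open>p < n\<close>] not_False_eq_True)
    qed
    have card: "card ?C = n - f"
      using F(2,3)[of i] by (simp add: card_Diff_subset finite_subset)
    have "{p \<in> ?C. broadcasts_before (?L \<omega>) p (g i) (g (Suc i mod n))} = ?C"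
      "{p \<in> ?C. broadcasts_before (?L \<omega>) p (g (Suc i mod n)) (g i)} = {}"
      using C by blast+
    then have "num_before ?C (?L \<omega>) (g i) (g (Suc i mod n)) = n - f"
      "num_before ?C (?L \<omega>) (g (Suc i mod n)) (g i) = 0"
      by (simp_all only: num_before_def card card.empty)
    then have none: "\<forall>p\<in>?C. \<not> delivers_before (?L \<omega>) p (g (Suc i mod n)) (g i)"
      using fair[of i] \<mu> all i j unfolding order_fair_def by auto
    have "card ?C > 0" using card assms(1) by simp
    \<comment> \<open>Process \<open>0\<close> may lie in \<open>F i\<close>, out of reach of
      fairness; total order carries \<open>rev\<close> over to a process outside
      \<open>F i\<close>.\<close>
    then obtain p where p: "p \<in> ?C" by (metis card_gt_0_iff ex_in_conv)
    then have "delivers_before (?L \<omega>) p (g (Suc i mod n)) (g i)"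
      using total[unfolded total_order_def, rule_format, of 0 p "g (Suc i mod n)" "g i"]
        rev deliver i j f by simp
    with none p show False by blast
  qed
  \<comment> \<open>One delivery list of process \<open>0\<close> contains the whole cycle, so some
    payload in it follows its cyclic successor.\<close>
  moreover obtain t where t: "g ` {..<n} \<subseteq> set (deliveries 0 (?L \<omega> t))"
    using deliveries_contain_finite[of "g ` {..<n}" n P "?A {}" \<omega> 0] deliver f by auto
  moreover have "distinct (deliveries 0 (?L \<omega> t))"
    using nodup f unfolding no_duplication_def by auto
  ultimately show False
    using cyclic_successor_not_total[of "deliveries 0 (?L \<omega> t)" n g] f g
    unfolding delivers_before_def by (meson inj_on_subset subset_UNIV)
qed

end
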